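(* Let $A$ be a unital associative $k$-algebra with unit $i$ and let $\gamma:A\to A$ be a $TD$-operator. Define three binary operations $\prec_\gamma,\succ_\gamma,\circ_\gamma:A^{\otimes 2}\to A$ by $$x\prec_\gamma y:=x\gamma(y),\qquad x\succ_\gamma y:=\gamma(x)y,\qquad x\circ_\gamma y:=-x\gamma(i)y$$ for all $x,y\in A$. Then $A^\gamma:=(A,\prec_\gamma,\succ_\gamma,\circ_\gamma)$ is a dendriform trialgebra. The operation $\bar\star_\gamma:A^{\otimes 2}\to A$ defined by $x\,\bar\star_\gamma\, y:=x\gamma(y)+\gamma(x)y-x\gamma(i)y$ is associative.
   Context: Throughout, $k$ is a field of characteristic zero. A $TD$-operator on a unital associative algebra $A$ with unit $i$ is a linear map $\gamma:A\to A$ such that $\gamma(x)\gamma(y)=\gamma(\gamma(x)y+x\gamma(y)-x\gamma(i)y)$ for all $x,y\in A$. A dendriform trialgebra is a $k$-vector space $T$ with three bilinear operations $\prec,\succ,\circ$ such that, with $x\star y:=x\prec y+x\succ y+x\circ y$, for all $x,y,z$: $(x\prec y)\prec z=x\prec(y\star z)$; $(x\succ y)\prec z=x\succ(y\prec z)$; $(x\star y)\succ z=x\succ(y\succ z)$; $(x\succ y)\circ z=x\succ(y\circ z)$; $(x\prec y)\circ z=x\circ(y\succ z)$; $(x\circ y)\prec z=x\circ(y\prec z)$; $(x\circ y)\circ z=x\circ(y\circ z)$. *)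

theory Defs
  imports Complex_Main
begin

(* A bilinear operation on a vector space V, i.e. the data of a linear map
   V \<otimes> V \<rightarrow> V, written in curried form. *)
locale bilinear_operation = vector_space scale
  for scale :: "'k::field \<Rightarrow> 'v::ab_group_add \<Rightarrow> 'v" +
  fixes f :: "'v \<Rightarrow> 'v \<Rightarrow> 'v"
  assumes linear_left: "Vector_Spaces.linear scale scale (\<lambda>x. f x y)"
    and linear_right: "Vector_Spaces.linear scale scale (\<lambda>y. f x y)"

(* The product is that of the type class ring (associative, not assumed
   commutative).  The unit is an explicit parameter, instead of using the class
   ring_1, because the latter would exclude the zero algebra. *)
locale unital_associative_algebra = bilinear_operation scale times
  for scale :: "'k::field \<Rightarrow> 'a::ring \<Rightarrow> 'a" +
  fixes unit :: 'a
  assumes unit_left: "unit * x = x"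
    and unit_right: "x * unit = x"

locale TD_operator = unital_associative_algebra scale unit
  for scale :: "'k::field \<Rightarrow> 'a::ring \<Rightarrow> 'a" and unit :: 'a +
  fixes \<gamma> :: "'a \<Rightarrow> 'a"
  assumes linear: "Vector_Spaces.linear scale scale \<gamma>"
    and TD: "\<gamma> x * \<gamma> y = \<gamma> (\<gamma> x * y + x * \<gamma> y - x * \<gamma> unit * y)"

locale dendriform_trialgebra = vector_space scale
  for scale :: "'k::field \<Rightarrow> 'v::ab_group_add \<Rightarrow> 'v" +
  fixes prec :: "'v \<Rightarrow> 'v \<Rightarrow> 'v"  (infixl \<open>\<prec>\<close> 70)
    and succ :: "'v \<Rightarrow> 'v \<Rightarrow> 'v"  (infixl \<open>\<succ>\<close> 70)
    and circ :: "'v \<Rightarrow> 'v \<Rightarrow> 'v"  (infixl \<open>\<odot>\<close> 70)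
    and star :: "'v \<Rightarrow> 'v \<Rightarrow> 'v"  (infixl \<open>\<star>\<close> 70)
  defines "x \<star> y \<equiv> x \<prec> y + x \<succ> y + x \<odot> y"
  assumes bilinear_prec: "bilinear_operation scale (\<prec>)"
    and bilinear_succ: "bilinear_operation scale (\<succ>)"
    and bilinear_circ: "bilinear_operation scale (\<odot>)"
    and prec_prec: "(x \<prec> y) \<prec> z = x \<prec> (y \<star> z)"
    and succ_prec: "(x \<succ> y) \<prec> z = x \<succ> (y \<prec> z)"
    and star_succ: "(x \<star> y) \<succ> z = x \<succ> (y \<succ> z)"
    and succ_circ: "(x \<succ> y) \<odot> z = x \<succ> (y \<odot> z)"
    and prec_circ: "(x \<prec> y) \<odot> z = x \<odot> (y \<succ> z)"
    and circ_prec: "(x \<odot> y) \<prec> z = x \<odot> (y \<prec> z)"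
    and circ_circ: "(x \<odot> y) \<odot> z = x \<odot> (y \<odot> z)"

definition TD_prec :: "('a::ring \<Rightarrow> 'a) \<Rightarrow> 'a \<Rightarrow> 'a \<Rightarrow> 'a"
  where "TD_prec \<gamma> x y = x * \<gamma> y"

definition TD_succ :: "('a::ring \<Rightarrow> 'a) \<Rightarrow> 'a \<Rightarrow> 'a \<Rightarrow> 'a"
  where "TD_succ \<gamma> x y = \<gamma> x * y"

definition TD_circ :: "'a::ring \<Rightarrow> ('a \<Rightarrow> 'a) \<Rightarrow> 'a \<Rightarrow> 'a \<Rightarrow> 'a"
  where "TD_circ unit \<gamma> x y = - (x * \<gamma> unit * y)"

definition TD_star :: "'a::ring \<Rightarrow> ('a \<Rightarrow> 'a) \<Rightarrow> 'a \<Rightarrow> 'a \<Rightarrow> 'a"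
  where "TD_star unit \<gamma> x y = x * \<gamma> y + \<gamma> x * y - x * \<gamma> unit * y"

end

theory Submission
  imports Defs
begin

text \<open>Taking one argument of the \<open>TD\<close> identity to be the unit shows that \<open>\<gamma> i\<close> commutes with the image of
  \<open>\<gamma>\<close>. This gives the axiom relating \<open>\<prec>\<close>, \<open>\<circ>\<close> and \<open>\<succ>\<close>; the \<open>TD\<close> identity itself gives the two axioms
  involving \<open>\<star>\<close>, and the other four hold because the product is associative. The sum of the seven
  axioms is the associativity of \<open>\<star>\<close>.\<close>

lemma (in vector_space) bilinear_operationI:
  assumes "\<And>x y z. f (x + y) z = f x z + f y z"
    and "\<And>x y z. f x (y + z) = f x y + f x z"
    and "\<And>c x y. f (scale c x) y = scale c (f x y)"
    and "\<And>c x y. f x (scale c y) = scale c (f x y)"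
  shows "bilinear_operation scale f"
  by unfold_locales (simp_all add: assms)

context bilinear_operation
begin

lemma add_left: "f (x + y) z = f x z + f y z"
  using linear_left by (simp add: Vector_Spaces.linear_iff)

lemma add_right: "f x (y + z) = f x y + f x z"
  using linear_right by (simp add: Vector_Spaces.linear_iff)

lemma scale_left: "f (scale c x) y = scale c (f x y)"
  using linear_left by (simp add: Vector_Spaces.linear_iff)

lemma scale_right: "f x (scale c y) = scale c (f x y)"
  using linear_right by (simp add: Vector_Spaces.linear_iff)

end

context dendriform_trialgebra
begin

sublocale prec: bilinear_operation scale "(\<prec>)" by (rule bilinear_prec)
sublocale succ: bilinear_operation scale "(\<succ>)" by (rule bilinear_succ)
sublocale circ: bilinear_operation scale "(\<odot>)" by (rule bilinear_circ)

lemma bilinear_star: "bilinear_operation scale (\<star>)"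
  by (rule bilinear_operationI)
    (simp_all add: star_def prec.add_left succ.add_left circ.add_left
      prec.add_right succ.add_right circ.add_right
      prec.scale_left succ.scale_left circ.scale_left
      prec.scale_right succ.scale_right circ.scale_right scale_right_distrib)

lemma star_assoc: "(x \<star> y) \<star> z = x \<star> (y \<star> z)"
proof -
  have "(x \<star> y) \<star> z = (x \<star> y) \<prec> z + (x \<star> y) \<succ> z + (x \<star> y) \<odot> z"
    by (simp add: star_def)
  \<comment> \<open>Only the first and third summands are expanded: \<open>star_succ\<close> applies
    to \<open>x \<star> y\<close> as a whole.\<close>
  also have "(x \<star> y) \<prec> z = x \<prec> (y \<star> z) + x \<succ> (y \<prec> z) + x \<odot> (y \<prec> z)"
    by (simp only: star_def[of x y] prec.add_left prec_prec succ_prec circ_prec)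
  also have "(x \<star> y) \<odot> z = x \<odot> (y \<succ> z) + x \<succ> (y \<odot> z) + x \<odot> (y \<odot> z)"
    by (simp only: star_def[of x y] circ.add_left prec_circ succ_circ circ_circ)
  finally show ?thesis
    by (simp add: star_succ star_def[of x "y \<star> z"])
      (simp add: star_def[of y z] succ.add_right circ.add_right ac_simps)
qed

end

context TD_operator
begin

lemma gamma_add: "\<gamma> (x + y) = \<gamma> x + \<gamma> y"
  using linear by (simp add: Vector_Spaces.linear_iff)

lemma gamma_scale: "\<gamma> (scale c x) = scale c (\<gamma> x)"
  using linear by (simp add: Vector_Spaces.linear_iff)

lemma gamma_unit_commute: "\<gamma> unit * \<gamma> x = \<gamma> x * \<gamma> unit"
proof -
  \<comment> \<open>With \<open>unit\<close> on the left, the first and third terms inside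
    \<open>\<gamma>\<close> cancel; with \<open>unit\<close> on the right, the second and third do.
    What remains is \<open>\<gamma> x\<close> both times.\<close>
  have "\<gamma> unit * \<gamma> x = \<gamma> (\<gamma> x)"
    using TD[of unit x] by (simp add: unit_left)
  moreover have "\<gamma> x * \<gamma> unit = \<gamma> (\<gamma> x)"
    using TD[of x unit] by (simp add: unit_right)
  ultimately show ?thesis by simp
qed

lemma TD_star_eq_sum: "TD_prec \<gamma> x y + TD_succ \<gamma> x y + TD_circ unit \<gamma> x y = TD_star unit \<gamma> x y"
  by (simp add: TD_prec_def TD_succ_def TD_circ_def TD_star_def)

text \<open>The \<open>TD\<close> identity, oriented so that rewriting removes
  \<open>\<gamma>\<close> of a star product; this is what \<open>prec_prec\<close> and
  \<open>star_succ\<close> require.\<close>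

lemma gamma_TD_star: "\<gamma> (TD_star unit \<gamma> x y) = \<gamma> x * \<gamma> y"
  by (simp add: TD TD_star_def add.commute)

lemma dendriform_trialgebra_TD:
  "dendriform_trialgebra scale (TD_prec \<gamma>) (TD_succ \<gamma>) (TD_circ unit \<gamma>)"
\<comment> \<open>The locale predicate spells out the star product as a sum of three terms;
  unfolding \<open>TD_star_eq_sum\<close> folds it into \<open>TD_star\<close>.\<close>
proof (intro dendriform_trialgebra.intro dendriform_trialgebra_axioms.intro vector_space_axioms,
    unfold TD_star_eq_sum)
  show "bilinear_operation scale (TD_prec \<gamma>)" "bilinear_operation scale (TD_succ \<gamma>)"
    "bilinear_operation scale (TD_circ unit \<gamma>)"
    by (rule bilinear_operationI;
        simp add: TD_prec_def TD_succ_def TD_circ_def gamma_add gamma_scale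
          distrib_left distrib_right scale_left scale_right)+
next
  fix x y z
  \<comment> \<open>The two sides differ by the order of the adjacent factors
    \<open>\<gamma> y\<close> and \<open>\<gamma> unit\<close>.\<close>
  show "TD_circ unit \<gamma> (TD_prec \<gamma> x y) z = TD_circ unit \<gamma> x (TD_succ \<gamma> y z)"
    unfolding TD_prec_def TD_succ_def TD_circ_def by (metis gamma_unit_commute mult.assoc)
qed (simp_all add: TD_prec_def TD_succ_def TD_circ_def gamma_TD_star mult.assoc)

end

theorem proposition2p5:
  fixes scale :: "'k::field_char_0 \<Rightarrow> 'a::ring \<Rightarrow> 'a"
    and i :: 'a
    and \<gamma> :: "'a \<Rightarrow> 'a"
  assumes "unital_associative_algebra scale i"
    and "TD_operator scale i \<gamma>"
  shows "dendriform_trialgebra scale (TD_prec \<gamma>) (TD_succ \<gamma>) (TD_circ i \<gamma>) \<and>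
    bilinear_operation scale (TD_star i \<gamma>) \<and>
    (\<forall>x y z. TD_star i \<gamma> (TD_star i \<gamma> x y) z = TD_star i \<gamma> x (TD_star i \<gamma> y z))"
proof -
  interpret TD_operator scale i \<gamma> by (rule assms(2))
  \<comment> \<open>Supplying \<open>TD_star\<close> for the derived product leaves its defining
    equation as a goal, and the general facts about \<open>\<star>\<close> then speak of
    \<open>TD_star\<close>.\<close>
  interpret T: dendriform_trialgebra scale "TD_prec \<gamma>" "TD_succ \<gamma>" "TD_circ i \<gamma>" "TD_star i \<gamma>"
    by (rule dendriform_trialgebra_TD) (simp add: TD_star_eq_sum)
  show ?thesis
    using dendriform_trialgebra_TD T.bilinear_star T.star_assoc by blast
qed

end
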